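(* Let $n\ge 1$ and let $P \subset \mathbb{Z}_{+}^{n}$ be a nonempty finite set. Then $P$ is a discrete polymatroid on the ground set $[n]$ if and only if $\operatorname{conv}(P) \subset \mathbb{R}_{+}^{n}$ is an integral polymatroid on the ground set $[n]$ with $\operatorname{conv}(P) \cap \mathbb{Z}^{n} = P$.
   Context: Notation: $[n]=\{1,\dots,n\}$; $\mathbb{R}_+^n$ is the set of vectors in $\mathbb{R}^n$ with nonnegative entries, $\mathbb{Z}_+^n=\mathbb{R}_+^n\cap\mathbb{Z}^n$. For $u\in\mathbb{R}_+^n$, $|u|=\sum_i u(i)$ is its modulus. $u\le v$ means $u(i)\le v(i)$ for all $i$; $u<v$ means $u\le v$ and $u\ne v$; $u\vee v$ is the componentwise maximum. $\operatorname{conv}(P)$ is the convex hull of $P$ in $\mathbb{R}^n$. A discrete polymatroid on $[n]$ is a nonempty finite set $P\subset\mathbb{Z}_+^n$ such that (D1) if $u\in P$, $v\in\mathbb{Z}_+^n$ and $v\le u$, then $v\in P$; (D2) if $u,v\in P$ with $|v|>|u|$, then there is $w\in P$ with $u<w\le u\vee v$. A polymatroid on $[n]$ is a nonempty compact subset $\mathcal{P}\subset\mathbb{R}_+^n$ such that (P1) if $u\in\mathcal{P}$, $v\in\mathbb{R}_+^n$ and $v\le u$, then $v\in\mathcal{P}$; (P2) if $u,v\in\mathcal{P}$ with $|v|>|u|$, then there is $w\in\mathcal{P}$ with $u<w\le u\vee v$. Every polymatroid is a convex polytope; it is called integral if all its vertices have integer coordinates. *)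

theory Defs
  imports "HOL-Analysis.Analysis"
begin

text \<open>
  The ground set \<open>[n]\<close> is the finite index type \<^typ>\<open>'n\<close>.  On \<^typ>\<open>real ^ 'n\<close> the library's
  \<open>\<le>\<close> is the componentwise order, \<open><\<close> its strict part (\<open>\<le>\<close> and \<open>\<noteq>\<close>) and \<open>sup\<close> the componentwise
  maximum.  The library's \<open>\<bar>u\<bar>\<close> is the vector of absolute values, hence the separate constant
  \<open>modulus\<close>.
\<close>

definition nonneg_orthant :: "(real ^ 'n) set" where
  "nonneg_orthant = {u. \<forall>i. 0 \<le> u $ i}"

definition integer_lattice :: "(real ^ 'n) set" where
  "integer_lattice = {u. \<forall>i. u $ i \<in> \<int>}"

definition modulus :: "real ^ 'n \<Rightarrow> real" where
  "modulus u = (\<Sum>i\<in>UNIV. u $ i)"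

definition discrete_polymatroid :: "(real ^ 'n) set \<Rightarrow> bool" where
  "discrete_polymatroid P \<longleftrightarrow>
     P \<noteq> {} \<and> finite P \<and> P \<subseteq> nonneg_orthant \<inter> integer_lattice \<and>
     (\<forall>u\<in>P. \<forall>v \<in> nonneg_orthant \<inter> integer_lattice. v \<le> u \<longrightarrow> v \<in> P) \<and>
     (\<forall>u\<in>P. \<forall>v\<in>P. modulus v > modulus u \<longrightarrow> (\<exists>w\<in>P. u < w \<and> w \<le> sup u v))"

definition polymatroid :: "(real ^ 'n) set \<Rightarrow> bool" where
  "polymatroid S \<longleftrightarrow>
     S \<noteq> {} \<and> compact S \<and> S \<subseteq> nonneg_orthant \<and>
     (\<forall>u\<in>S. \<forall>v \<in> nonneg_orthant. v \<le> u \<longrightarrow> v \<in> S) \<and>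
     (\<forall>u\<in>S. \<forall>v\<in>S. modulus v > modulus u \<longrightarrow> (\<exists>w\<in>S. u < w \<and> w \<le> sup u v))"

text \<open>
  The vertices of a convex polytope are its extreme points.  That a polymatroid is a polytope is a
  theorem and hence not part of the definition.
\<close>

definition integral_polymatroid :: "(real ^ 'n) set \<Rightarrow> bool" where
  "integral_polymatroid S \<longleftrightarrow>
     polymatroid S \<and> (\<forall>v. v extreme_point_of S \<longrightarrow> v \<in> integer_lattice)"

end

theory Submission
  imports Defs
begin

text \<open>
  A polymatroid is determined by its rank function: if \<open>r A\<close> is the largest value of the partial
  coordinate sum \<open>x(A)\<close> on \<open>S\<close>, then \<open>r\<close> is submodular and \<open>S\<close> consists of all nonnegative
  \<open>x\<close> with \<open>x(A) \<le> r A\<close> for every \<open>A\<close>.  The same holds for a discrete polymatroid, except that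
  \<open>x\<close> then runs over the integer vectors only.  Both facts are instances of
  \<open>eq_rank_polytope\<close>, which is proved for an arbitrary grid of admissible vectors, the two grids
  of interest being the whole space and the integer lattice.

  For the passage from \<open>P\<close> to its convex hull, consider the polytope \<open>Q\<close> cut out by the rank
  function of \<open>P\<close>.  It is a polymatroid by \<open>polymatroid_rank_polytope\<close>, and since the rank
  function is submodular and integer valued, its extreme points are integral
  (\<open>extreme_point_integral\<close>).  The integer points of \<open>Q\<close> are exactly \<open>P\<close>, so by the
  Krein-Milman theorem \<open>Q\<close> is the convex hull of \<open>P\<close>.

  Conversely, if the convex hull of \<open>P\<close> is a polymatroid, its rank function is integer valued,
  because a linear function attains its maximum over the hull on \<open>P\<close>.  Let \<open>u\<close> and \<open>v\<close> be
  points of \<open>P\<close> with \<open>|u| < |v|\<close>.  By \<open>nontight_coordinate\<close> there is a coordinate \<open>i\<close> with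
  \<open>u(i) < v(i)\<close> such that no constraint involving \<open>i\<close> is tight at \<open>u\<close>.  All slacks are
  integers, so \<open>u\<close> may be raised at \<open>i\<close> by a full unit, which is the discrete exchange property.
\<close>

section \<open>Partial coordinate sums and rank polytopes\<close>

definition weight :: "real ^ 'n \<Rightarrow> 'n set \<Rightarrow> real" where
  "weight x A = (\<Sum>i\<in>A. x $ i)"

definition submodular :: "('n set \<Rightarrow> real) \<Rightarrow> bool" where
  "submodular r \<longleftrightarrow> (\<forall>A B. r (A \<union> B) + r (A \<inter> B) \<le> r A + r B)"

definition rank_polytope :: "('n set \<Rightarrow> real) \<Rightarrow> (real ^ 'n) set" where
  "rank_polytope r = {x \<in> nonneg_orthant. \<forall>A. weight x A \<le> r A}"

definition rank_of :: "(real ^ 'n) set \<Rightarrow> 'n set \<Rightarrow> real" where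
  "rank_of S A = Sup ((\<lambda>x. weight x A) ` S)"

definition glue :: "'n set \<Rightarrow> real ^ 'n \<Rightarrow> real ^ 'n \<Rightarrow> real ^ 'n" where
  "glue A x y = (\<chi> i. if i \<in> A then x $ i else y $ i)"

lemma glue_component [simp]: "glue A x y $ i = (if i \<in> A then x $ i else y $ i)"
  by (simp add: glue_def)

lemma sup_component [simp]: "sup x y $ i = max (x $ i) (y $ i)" for x y :: "real ^ 'n"
  by (simp add: sup_vec_def sup_max)

lemma inf_component [simp]: "inf x y $ i = min (x $ i) (y $ i)" for x y :: "real ^ 'n"
  by (simp add: inf_vec_def inf_min)

lemma less_vec_iff: "x < y \<longleftrightarrow> x \<le> y \<and> (\<exists>i. x $ i < y $ i)" for x y :: "real ^ 'n"
  by (auto simp: less_vec_def less_eq_vec_def not_le)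

lemma modulus_eq_weight: "modulus x = weight x UNIV"
  by (simp add: modulus_def weight_def)

lemma weight_mono: "(\<And>i. i \<in> A \<Longrightarrow> x $ i \<le> y $ i) \<Longrightarrow> weight x A \<le> weight y A"
  by (simp add: weight_def sum_mono)

lemma weight_cong: "(\<And>i. i \<in> A \<Longrightarrow> x $ i = y $ i) \<Longrightarrow> weight x A = weight y A"
  by (simp add: weight_def)

lemma weight_strict_mono:
  "(\<And>i. i \<in> A \<Longrightarrow> x $ i \<le> y $ i) \<Longrightarrow> k \<in> A \<Longrightarrow> x $ k < y $ k \<Longrightarrow> weight x A < weight y A"
  by (auto simp: weight_def intro!: sum_strict_mono_ex1)

lemma weight_add: "weight (x + y) A = weight x A + weight y A"
  by (simp add: weight_def sum.distrib)

lemma weight_scaleR: "weight (s *\<^sub>R x) A = s * weight x A"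
  by (simp add: weight_def sum_distrib_left)

lemma weight_axis: "weight (axis i a) A = (if i \<in> A then a else 0)"
  by (auto simp: weight_def axis_def)

lemma weight_Un_Int: "weight x (A \<union> B) + weight x (A \<inter> B) = weight x A + weight x B"
  by (simp add: weight_def sum.union_inter)

lemma weight_split: "modulus x = weight x A + weight x (- A)"
  using weight_Un_Int[of x A "- A"] by (simp add: modulus_eq_weight weight_def)

lemma modulus_less: "x < y \<Longrightarrow> modulus x < modulus y"
  by (auto simp: less_vec_iff less_eq_vec_def modulus_eq_weight intro: weight_strict_mono)

lemma modulus_mono: "x \<le> y \<Longrightarrow> modulus x \<le> modulus y"
  by (auto simp: less_eq_vec_def modulus_eq_weight intro: weight_mono)

lemma modulus_glue: "modulus (glue A x y) = weight x A + weight y (- A)"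
  unfolding weight_split[of "glue A x y" A] by (simp add: weight_def)

lemma continuous_on_weight: "continuous_on S (\<lambda>x. weight x A)"
  unfolding weight_def by (intro continuous_intros)

section \<open>Polymatroids over a grid and their rank functions\<close>

text \<open>
  The polymatroid axioms relative to a set \<open>G\<close> of admissible vectors.  Gluing two vectors
  of \<open>G\<close> along a set of coordinates yields restrictions (by gluing with \<open>0\<close>) and
  componentwise minima, the two constructions that the rank theory applies to points of \<open>S\<close>.  Compactness of \<open>S\<close> stands for finiteness
  in the discrete case.
\<close>

locale grid_polymatroid =
  fixes G S :: "(real ^ 'n) set"
  assumes zero_grid: "0 \<in> G"
    and glue_grid: "x \<in> G \<Longrightarrow> y \<in> G \<Longrightarrow> glue A x y \<in> G"
    and nonempty: "S \<noteq> {}"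
    and compact: "compact S"
    and subset: "S \<subseteq> nonneg_orthant \<inter> G"
    and down: "u \<in> S \<Longrightarrow> v \<in> nonneg_orthant \<inter> G \<Longrightarrow> v \<le> u \<Longrightarrow> v \<in> S"
    and exchange: "u \<in> S \<Longrightarrow> v \<in> S \<Longrightarrow> modulus u < modulus v \<Longrightarrow> \<exists>w\<in>S. u < w \<and> w \<le> sup u v"
begin

lemma nonneg: "u \<in> S \<Longrightarrow> 0 \<le> u $ i"
  using subset by (auto simp: nonneg_orthant_def)

lemma glue_in:
  assumes "x \<in> S" "y \<in> S" "z \<in> S" "glue A x y \<le> z"
  shows "glue A x y \<in> S"
proof (rule down[OF assms(3) _ assms(4)])
  have "x \<in> G" "y \<in> G" using assms subset by auto
  then show "glue A x y \<in> nonneg_orthant \<inter> G"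
    using assms nonneg glue_grid by (auto simp: nonneg_orthant_def)
qed

lemma zero_in: "0 \<in> S"
proof -
  obtain u where "u \<in> S" using nonempty by blast
  then show ?thesis
    by (rule down) (use nonneg[OF \<open>u \<in> S\<close>] zero_grid in \<open>auto simp: nonneg_orthant_def less_eq_vec_def\<close>)
qed

lemma restrict_in: "u \<in> S \<Longrightarrow> glue A u 0 \<in> S"
  by (rule glue_in[where z = u]) (simp_all add: zero_in less_eq_vec_def nonneg)

lemma inf_in:
  assumes "w \<in> S" "c \<in> nonneg_orthant \<inter> G"
  shows "inf w c \<in> S"
proof -
  have "inf w c = glue {i. w $ i \<le> c $ i} w c"
    by (auto simp: vec_eq_iff min_def)
  moreover have "glue {i. w $ i \<le> c $ i} w c \<in> G"
    using assms subset glue_grid by auto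
  ultimately have "inf w c \<in> nonneg_orthant \<inter> G"
    using assms nonneg by (auto simp: nonneg_orthant_def)
  then show ?thesis by (rule down[OF assms(1)]) simp
qed

lemma bounded_above: "\<exists>b. \<forall>z\<in>S. z \<le> b"
proof -
  have "\<exists>b. \<forall>z\<in>S. z $ i \<le> b" for i
  proof -
    have "continuous_on S (\<lambda>z. z $ i)" by (intro continuous_intros)
    then show ?thesis using continuous_attains_sup[OF compact nonempty] by blast
  qed
  then have "\<exists>b. \<forall>i. \<forall>z\<in>S. z $ i \<le> b i" by (intro choice allI)
  then obtain b where "\<forall>i. \<forall>z\<in>S. z $ i \<le> b i" by blast
  then show ?thesis
    by (intro exI[of _ "\<chi> i. b i"]) (auto simp: less_eq_vec_def)
qed

text \<open>
  The analogue of extending an independent set to a basis.  A point that is largest among those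
  between \<open>u\<close> and \<open>c\<close> is already largest among all points below \<open>c\<close>, since the exchange
  property could otherwise enlarge it without leaving the box.
\<close>

lemma extend:
  assumes "u \<in> S" "u \<le> c"
  obtains w where "w \<in> S" "u \<le> w" "w \<le> c" "\<And>z. z \<in> S \<Longrightarrow> z \<le> c \<Longrightarrow> modulus z \<le> modulus w"
proof -
  have "compact (S \<inter> {u..c})"
    using compact by (intro compact_Int_closed closed_atLeastAtMost) auto
  moreover have "S \<inter> {u..c} \<noteq> {}" using assms by auto
  ultimately obtain w where w: "w \<in> S" "u \<le> w" "w \<le> c"
    and max: "\<And>z. z \<in> S \<Longrightarrow> u \<le> z \<Longrightarrow> z \<le> c \<Longrightarrow> modulus z \<le> modulus w"
    using continuous_attains_sup[of "S \<inter> {u..c}" "\<lambda>z. weight z UNIV"]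
      continuous_on_weight[of "S \<inter> {u..c}" UNIV]
    unfolding modulus_eq_weight by (metis IntE IntI atLeastAtMost_iff)
  have "modulus z \<le> modulus w" if "z \<in> S" "z \<le> c" for z
  proof (rule ccontr)
    assume "\<not> modulus z \<le> modulus w"
    then obtain w' where w': "w' \<in> S" "w < w'" "w' \<le> sup w z"
      using exchange[OF w(1) \<open>z \<in> S\<close>] by auto
    moreover have "sup w z \<le> c" using w that by simp
    ultimately have "modulus w' \<le> modulus w"
      using max[of w'] w by (meson order.trans less_imp_le)
    then show False using modulus_less[OF w'(2)] by simp
  qed
  then show ?thesis using that w by blast
qed

lemma rank_attained: "\<exists>u\<in>S. weight u A = rank_of S A"
  and weight_le_rank: "u \<in> S \<Longrightarrow> weight u A \<le> rank_of S A"
proof -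
  obtain v where v: "v \<in> S" "\<forall>x\<in>S. weight x A \<le> weight v A"
    using continuous_attains_sup[OF compact nonempty continuous_on_weight] by blast
  then have "rank_of S A = weight v A"
    unfolding rank_of_def by (intro cSup_eq_maximum) auto
  then show "\<exists>u\<in>S. weight u A = rank_of S A" "u \<in> S \<Longrightarrow> weight u A \<le> rank_of S A"
    using v by auto
qed

text \<open>By downward closure the maximiser may be taken to vanish outside \<open>A\<close>.\<close>

lemma rank_attained_on:
  obtains u where "u \<in> S" "\<And>i. i \<notin> A \<Longrightarrow> u $ i = 0" "weight u A = rank_of S A"
proof -
  obtain u where "u \<in> S" "weight u A = rank_of S A" using rank_attained by blast
  then show ?thesis
    by (intro that[of "glue A u 0"]) (auto simp: restrict_in cong: weight_cong)
qed

text \<open>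
  A maximiser for \<open>A \<inter> B\<close> extends to one for \<open>A \<union> B\<close>.  The extended point is
  optimal for both sets at once, so the modular identity for its partial sums bounds the ranks.
\<close>

lemma submodular_rank: "submodular (rank_of S)"
  unfolding submodular_def
proof (intro allI)
  fix A B
  obtain b where b: "\<And>z. z \<in> S \<Longrightarrow> z \<le> b" using bounded_above by blast
  define c where "c = glue (A \<union> B) b 0"
  obtain u where u: "u \<in> S" "\<And>i. i \<notin> A \<inter> B \<Longrightarrow> u $ i = 0"
      "weight u (A \<inter> B) = rank_of S (A \<inter> B)"
    using rank_attained_on[where A = "A \<inter> B"] by metis
  obtain v where v: "v \<in> S" "\<And>i. i \<notin> A \<union> B \<Longrightarrow> v $ i = 0"
      "weight v (A \<union> B) = rank_of S (A \<union> B)"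
    using rank_attained_on[where A = "A \<union> B"] by metis
  have le_c: "z \<le> c" if "z \<in> S" "\<And>i. i \<notin> A \<union> B \<Longrightarrow> z $ i = 0" for z
    using that b[of z] by (auto simp: c_def less_eq_vec_def)
  have "u \<le> c" using u by (intro le_c) auto
  then obtain w where w: "w \<in> S" "u \<le> w" "w \<le> c"
    and max: "\<And>z. z \<in> S \<Longrightarrow> z \<le> c \<Longrightarrow> modulus z \<le> modulus w"
    using extend[OF u(1)] by metis
  have w0: "w $ i = 0" if "i \<notin> A \<union> B" for i
    using that w(3) nonneg[OF w(1), of i] unfolding less_eq_vec_def c_def
    by (metis glue_component order.antisym zero_index)
  have modulus_supported: "modulus z = weight z (A \<union> B)"
    if "\<And>i. i \<notin> A \<union> B \<Longrightarrow> z $ i = 0" for z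
    using that by (subst weight_split[of _ "A \<union> B"]) (auto simp: weight_def)
  have "rank_of S (A \<union> B) \<le> weight w (A \<union> B)"
    using max[OF v(1) le_c[OF v(1,2)]] modulus_supported[OF v(2)] modulus_supported[OF w0] v(3)
    by simp
  moreover have "rank_of S (A \<inter> B) \<le> weight w (A \<inter> B)"
    using u(3) weight_mono[of "A \<inter> B" u w] w(2) by (auto simp: less_eq_vec_def)
  ultimately show "rank_of S (A \<union> B) + rank_of S (A \<inter> B) \<le> rank_of S A + rank_of S B"
    using weight_Un_Int[of w A B] weight_le_rank[OF w(1), of A] weight_le_rank[OF w(1), of B]
    by simp
qed

text \<open>
  For an independent set \<open>u\<close> of a matroid, with \<open>S\<close> the integer polymatroid of its
  independent sets, this is the closure of \<open>u\<close>.
\<close>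

definition blocked :: "real ^ 'n \<Rightarrow> 'n set" where
  "blocked u = {i. \<not> (\<exists>w\<in>S. u $ i < w $ i \<and> (\<forall>j. j \<noteq> i \<longrightarrow> w $ j = u $ j))}"

text \<open>
  Here \<open>c\<close> is \<open>u\<close> raised at a blocked coordinate.  Exchanging \<open>u\<close> with a larger point below
  \<open>c\<close> could only raise \<open>u\<close> at that coordinate.
\<close>

lemma no_larger_below:
  assumes "u \<in> S" "t \<in> blocked u" "\<And>j. j \<noteq> t \<Longrightarrow> c $ j = u $ j" "u $ t \<le> c $ t" "z \<in> S" "z \<le> c"
  shows "modulus z \<le> modulus u"
proof (rule ccontr)
  assume "\<not> modulus z \<le> modulus u"
  then obtain w where w: "w \<in> S" "u < w" "w \<le> sup u z"
    using exchange[OF assms(1,5)] by auto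
  have eq: "w $ j = u $ j" if "j \<noteq> t" for j
  proof -
    have "w $ j \<le> max (u $ j) (z $ j)" "z $ j \<le> u $ j" "u $ j \<le> w $ j"
      using w assms(6) assms(3)[OF that] by (auto simp: less_eq_vec_def less_vec_iff dest: spec[of _ j])
    then show ?thesis by simp
  qed
  then have "u $ t < w $ t"
    using w(2) unfolding less_vec_iff by (metis less_irrefl)
  then show False using eq w(1) assms(2) by (auto simp: blocked_def)
qed

text \<open>
  The blocked coordinates form a tight set.  If not, the restriction of \<open>u\<close> to them can be
  raised at some blocked \<open>t\<close>.  Extending the result again under \<open>c\<close>, which is \<open>u\<close> raised at
  \<open>t\<close>, gives a point \<open>x\<close> with \<open>|x| = |u|\<close>.  Since \<open>c\<close> itself is unattainable, \<open>x\<close> lies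
  below \<open>c\<close> in some coordinate \<open>k\<close>, which is not blocked.  But \<open>u\<close> can be raised at \<open>k\<close>, and
  this room suffices to raise \<open>x\<close> at \<open>k\<close>.  Capping at \<open>c\<close> leaves a point below \<open>c\<close> that is
  larger than \<open>u\<close>, contrary to \<open>no_larger_below\<close>.
\<close>

lemma weight_blocked:
  assumes u: "u \<in> S"
  shows "weight u (blocked u) = rank_of S (blocked u)"
proof (rule ccontr)
  let ?T = "blocked u"
  assume "weight u ?T \<noteq> rank_of S ?T"
  then have less: "weight u ?T < rank_of S ?T"
    using weight_le_rank[OF u, of ?T] by simp
  obtain v where v: "v \<in> S" "\<And>i. i \<notin> ?T \<Longrightarrow> v $ i = 0" "weight v ?T = rank_of S ?T"
    using rank_attained_on[where A = ?T] by metis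
  define uT where "uT = glue ?T u 0"
  have uT: "uT \<in> S" unfolding uT_def by (rule restrict_in[OF u])
  have "modulus uT = weight u ?T"
    unfolding uT_def modulus_glue by (simp add: weight_def)
  moreover have "modulus v = weight v ?T"
    using v(2) by (subst weight_split[of _ ?T]) (auto simp: weight_def)
  ultimately obtain w where w: "w \<in> S" "uT < w" "w \<le> sup uT v"
    using exchange[OF uT v(1)] less v(3) by auto
  then obtain t where t: "uT $ t < w $ t" by (auto simp: less_vec_iff)
  have "t \<in> ?T"
  proof (rule ccontr)
    assume "t \<notin> ?T"
    then have "sup uT v $ t = 0" "uT $ t = 0" using v(2) by (auto simp: uT_def)
    then show False using w(3) t by (metis less_eq_vec_def not_le)
  qed
  define c where "c = glue {t} w u"
  have ut: "u $ t < w $ t" using t \<open>t \<in> ?T\<close> by (simp add: uT_def)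
  have cj: "c $ j = u $ j" if "j \<noteq> t" for j using that by (simp add: c_def)
  have ct: "c $ t = w $ t" by (simp add: c_def)
  have uc: "u \<le> c" using ut by (auto simp: c_def less_eq_vec_def)
  have c_grid: "c \<in> nonneg_orthant \<inter> G"
    using u w(1) subset glue_grid[of w u "{t}"] unfolding c_def by (auto simp: nonneg_orthant_def)
  have c_notin: "c \<notin> S"
    using \<open>t \<in> ?T\<close> ut cj ct by (auto simp: blocked_def)
  have small: "modulus z \<le> modulus u" if "z \<in> S" "z \<le> c" for z
    using no_larger_below[OF u \<open>t \<in> ?T\<close> cj _ that] ut ct by simp

  \<comment> \<open>Only the coordinate \<open>t\<close> of the exchange is kept, so that \<open>y\<close> agrees with \<open>c\<close> on the
    blocked set and extending it under \<open>c\<close> changes nothing there.\<close>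
  define y where "y = glue {t} w uT"
  have "y \<in> S" unfolding y_def
    by (rule glue_in[OF w(1) uT w(1)]) (use w(2) in \<open>auto simp: less_eq_vec_def less_vec_iff\<close>)
  moreover have "y \<le> c"
    using nonneg[OF u] by (auto simp: y_def c_def uT_def less_eq_vec_def)
  ultimately obtain x where x: "x \<in> S" "y \<le> x" "x \<le> c"
    and max: "\<And>z. z \<in> S \<Longrightarrow> z \<le> c \<Longrightarrow> modulus z \<le> modulus x"
    using extend by metis
  have ux: "modulus u = modulus x" using max[OF u uc] small[OF x(1,3)] by simp
  have x_on_T: "x $ i = c $ i" if "i \<in> ?T" for i
  proof -
    have "y $ i \<le> x $ i" "x $ i \<le> c $ i" using x by (auto simp: less_eq_vec_def)
    moreover have "y $ i = c $ i" using that by (simp add: y_def c_def uT_def)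
    ultimately show ?thesis by simp
  qed
  obtain k where k: "x $ k < c $ k" using c_notin x(1,3) unfolding less_eq_vec_def
    by (metis order.not_eq_order_implies_strict vec_eq_iff)
  have "k \<notin> ?T" using x_on_T k by force
  then have "k \<noteq> t" using \<open>t \<in> ?T\<close> by auto
  obtain z where z: "z \<in> S" "u $ k < z $ k" "\<And>j. j \<noteq> k \<Longrightarrow> z $ j = u $ j"
    using \<open>k \<notin> ?T\<close> by (auto simp: blocked_def)
  have "u < z" using z unfolding less_vec_iff less_eq_vec_def
    by (metis order.refl less_imp_le)
  obtain x' where x': "x' \<in> S" "x \<le> x'" "x' \<le> sup x z"
    and "\<And>q. q \<in> S \<Longrightarrow> q \<le> sup x z \<Longrightarrow> modulus q \<le> modulus x'"
    using extend[OF x(1), of "sup x z"] sup_ge1 by metis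
  then have big: "modulus u < modulus x'"
    using modulus_less[OF \<open>u < z\<close>] z(1) sup_ge2 by (metis order.strict_trans2)
  have x'_le: "x' $ j \<le> c $ j" if "j \<noteq> k" for j
  proof -
    have "x' $ j \<le> max (x $ j) (z $ j)" using x'(3) by (auto simp: less_eq_vec_def)
    moreover have "x $ j \<le> c $ j" "u $ j \<le> c $ j" using x(3) uc by (auto simp: less_eq_vec_def)
    ultimately show ?thesis using z(3)[OF that] by simp
  qed
  \<comment> \<open>In the coordinate \<open>k\<close> the point \<open>x'\<close> may exceed \<open>c\<close>; every other coordinate is
    already at most that of \<open>c\<close>.\<close>
  define q where "q = inf x' c"
  have q: "q \<in> S" "q \<le> c" using inf_in[OF x'(1) c_grid] by (auto simp: q_def)
  have "modulus u < modulus q"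
  proof (cases "x' $ k \<le> c $ k")
    case True
    then have "x' \<le> c" using x'_le unfolding less_eq_vec_def by metis
    then have "q = x'" by (simp add: q_def inf_absorb1)
    then show ?thesis using big by simp
  next
    case False
    have "x \<le> q" using x'(2) x(3) by (simp add: q_def)
    moreover have "x $ k < q $ k" using False k by (simp add: q_def)
    ultimately show ?thesis using ux modulus_less[of x q] by (auto simp: less_vec_iff)
  qed
  then show False using small[OF q] by simp
qed

text \<open>
  Let \<open>x\<close> satisfy all rank constraints and let \<open>u\<close> be a largest point of \<open>S\<close> below \<open>x\<close>.
  Wherever \<open>u\<close> is below \<open>x\<close> it is blocked, by maximality.  As the blocked set is tight,
  \<open>x\<close> cannot exceed \<open>u\<close> on it.
\<close>

theorem eq_rank_polytope: "S = rank_polytope (rank_of S) \<inter> G"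
proof
  show "S \<subseteq> rank_polytope (rank_of S) \<inter> G"
    using subset weight_le_rank by (auto simp: rank_polytope_def)
  show "rank_polytope (rank_of S) \<inter> G \<subseteq> S"
  proof
    fix x assume x: "x \<in> rank_polytope (rank_of S) \<inter> G"
    then have x_grid: "x \<in> nonneg_orthant \<inter> G" by (auto simp: rank_polytope_def)
    then have "0 \<le> x" by (auto simp: nonneg_orthant_def less_eq_vec_def)
    then obtain u where u: "u \<in> S" "u \<le> x"
      and max: "\<And>z. z \<in> S \<Longrightarrow> z \<le> x \<Longrightarrow> modulus z \<le> modulus u"
      using extend[OF zero_in] by metis
    have ux: "u $ i \<le> x $ i" for i using u(2) by (simp add: less_eq_vec_def)
    have "i \<in> blocked u" if i: "u $ i < x $ i" for i
    proof (rule ccontr)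
      assume "i \<notin> blocked u"
      then obtain w where w: "w \<in> S" "u $ i < w $ i" "\<And>j. j \<noteq> i \<Longrightarrow> w $ j = u $ j"
        by (auto simp: blocked_def)
      have "u \<le> w" using w unfolding less_eq_vec_def by (metis order.refl less_imp_le)
      then have "u \<le> inf w x" using u(2) by simp
      then have "u < inf w x" using w(2) i unfolding less_vec_iff by (auto intro!: exI[of _ i])
      then show False
        using modulus_less max[OF inf_in[OF w(1) x_grid]] by fastforce
    qed
    moreover have "weight x (blocked u) \<le> weight u (blocked u)"
      using x unfolding weight_blocked[OF u(1)] by (simp add: rank_polytope_def)
    ultimately have "\<not> u $ i < x $ i" for i
      using weight_strict_mono[of "blocked u" u x i] ux by force
    then have "x = u" using ux by (simp add: vec_eq_iff order.antisym not_less)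
    then show "x \<in> S" using u(1) by simp
  qed
qed

end

section \<open>Rank polytopes of submodular functions\<close>

lemma tight_Un_Int:
  assumes "submodular r" "x \<in> rank_polytope r" "weight x A = r A" "weight x B = r B"
  shows "weight x (A \<union> B) = r (A \<union> B)" "weight x (A \<inter> B) = r (A \<inter> B)"
proof -
  have "weight x C \<le> r C" for C using assms(2) by (simp add: rank_polytope_def)
  from this[of "A \<union> B"] this[of "A \<inter> B"]
  show "weight x (A \<union> B) = r (A \<union> B)" "weight x (A \<inter> B) = r (A \<inter> B)"
    using assms(1,3,4) weight_Un_Int[of x A B] unfolding submodular_def
    by (smt (verit))+
qed

lemma tight_superset:
  assumes "submodular r" "x \<in> rank_polytope r" "finite I" "I \<noteq> {}"
    and "\<And>i. i \<in> I \<Longrightarrow> \<exists>A. i \<in> A \<and> weight x A = r A"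
  shows "\<exists>A. I \<subseteq> A \<and> weight x A = r A"
  using assms(3,4,5)
proof (induction I rule: finite_ne_induct)
  case (singleton i)
  then show ?case by auto
next
  case (insert i I)
  then obtain A B where "I \<subseteq> A" "weight x A = r A" "i \<in> B" "weight x B = r B"
    by (metis insertCI)
  then show ?case
    using tight_Un_Int(1)[OF assms(1,2)] by (intro exI[of _ "A \<union> B"]) auto
qed

text \<open>
  Otherwise the coordinates in which \<open>v\<close> exceeds \<open>u\<close> are covered by tight sets, hence by one
  tight set \<open>A\<close>.  Then \<open>v(A) \<le> r A = u(A)\<close>, and \<open>v \<le> u\<close> outside \<open>A\<close>, so \<open>|v| \<le> |u|\<close>.
  This is the common source of the exchange property for the polytope and for its
  integer points.
\<close>

lemma nontight_coordinate:
  assumes "submodular r" "u \<in> rank_polytope r" "v \<in> rank_polytope r" "modulus u < modulus v"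
  obtains i where "u $ i < v $ i" "\<And>A. i \<in> A \<Longrightarrow> weight u A < r A"
proof -
  have "\<exists>i. u $ i < v $ i \<and> (\<forall>A. i \<in> A \<longrightarrow> weight u A \<noteq> r A)"
  proof (rule ccontr)
    assume neg: "\<not> ?thesis"
    define N where "N = {i. u $ i < v $ i}"
    have "N \<noteq> {}"
      using assms(4) modulus_mono[of v u]
      by (auto simp: N_def less_eq_vec_def not_le[symmetric])
    then obtain A where A: "N \<subseteq> A" "weight u A = r A"
      using tight_superset[OF assms(1,2), of N] neg by (auto simp: N_def)
    have "weight v A \<le> weight u A"
      using assms(3) A by (simp add: rank_polytope_def)
    moreover have "weight v (- A) \<le> weight u (- A)"
      using A(1) by (intro weight_mono) (auto simp: N_def not_less[symmetric])
    ultimately show False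
      using assms(4) by (simp add: weight_split[of _ A])
  qed
  then show ?thesis
    using that assms(2) by (force simp: rank_polytope_def order.strict_iff_order)
qed

text \<open>
  There are finitely many constraints; those that are not tight survive a small move in any
  direction.
\<close>

lemma perturb:
  assumes x: "x \<in> rank_polytope r"
    and dir: "\<And>i. 0 \<le> d $ i \<or> 0 < x $ i"
    and slack: "\<And>A. weight d A \<le> 0 \<or> weight x A < r A"
  shows "\<exists>e>0. \<forall>s. 0 \<le> s \<and> s < e \<longrightarrow> x + s *\<^sub>R d \<in> rank_polytope r"
proof -
  have "\<forall>\<^sub>F s in nhds (0::real). 0 \<le> s \<longrightarrow> 0 \<le> x $ i + s * d $ i" for i
  proof (cases "0 \<le> d $ i")
    case True
    then show ?thesis
      using x by (intro always_eventually) (auto simp: rank_polytope_def nonneg_orthant_def)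
  next
    case False
    have "((\<lambda>s. x $ i + s * d $ i) \<longlongrightarrow> x $ i + 0 * d $ i) (nhds 0)"
      by (intro tendsto_intros filterlim_ident)
    then have "\<forall>\<^sub>F s in nhds 0. 0 < x $ i + s * d $ i"
      using dir[of i] False by (intro order_tendstoD(1)) auto
    then show ?thesis by (rule eventually_mono) simp
  qed
  moreover have "\<forall>\<^sub>F s in nhds (0::real). 0 \<le> s \<longrightarrow> weight x A + s * weight d A \<le> r A" for A
  proof (cases "weight d A \<le> 0")
    case True
    have "weight x A \<le> r A" using x by (simp add: rank_polytope_def)
    then show ?thesis
      using True by (intro always_eventually) (smt (verit) mult_nonneg_nonpos)
  next
    case False
    have "((\<lambda>s. weight x A + s * weight d A) \<longlongrightarrow> weight x A + 0 * weight d A) (nhds 0)"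
      by (intro tendsto_intros filterlim_ident)
    then have "\<forall>\<^sub>F s in nhds 0. weight x A + s * weight d A < r A"
      using slack[of A] False by (intro order_tendstoD(2)) auto
    then show ?thesis by (rule eventually_mono) simp
  qed
  ultimately have "\<forall>\<^sub>F s in nhds (0::real). (\<forall>i. 0 \<le> s \<longrightarrow> 0 \<le> x $ i + s * d $ i) \<and>
      (\<forall>A. 0 \<le> s \<longrightarrow> weight x A + s * weight d A \<le> r A)"
    by (intro eventually_conj eventually_all_finite)
  then show ?thesis
    unfolding eventually_nhds_metric
    by (auto simp: rank_polytope_def nonneg_orthant_def weight_add weight_scaleR dist_real_def)
qed

lemma polymatroid_rank_polytope:
  fixes r :: "'n::finite set \<Rightarrow> real"
  assumes "submodular r" and ne: "rank_polytope r \<noteq> {}"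
  shows "polymatroid (rank_polytope r)"
  unfolding polymatroid_def
proof (intro conjI ballI impI)
  have "rank_polytope r = (\<Inter>i. {x. 0 \<le> x $ i}) \<inter> (\<Inter>A. {x. weight x A \<le> r A})"
    by (auto simp: rank_polytope_def nonneg_orthant_def)
  moreover have "closed {x :: real ^ 'n. weight x A \<le> r A}" for A
    by (intro closed_Collect_le continuous_on_weight continuous_intros)
  moreover have "closed {x :: real ^ 'n. 0 \<le> x $ i}" for i
    by (intro closed_Collect_le continuous_intros)
  ultimately have closed: "closed (rank_polytope r)"
    by (simp add: closed_Int closed_INT)
  have "x \<in> {0..(\<chi> i. r {i})}" if "x \<in> rank_polytope r" for x
  proof -
    have "0 \<le> x $ i" "weight x {i} \<le> r {i}" for i
      using that unfolding rank_polytope_def nonneg_orthant_def by blast+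
    then show ?thesis by (simp add: weight_def less_eq_vec_def)
  qed
  then have "bounded (rank_polytope r)"
    by (intro bounded_subset[OF bounded_closed_interval] subsetI)
  then show "compact (rank_polytope r)" using closed by (simp add: compact_eq_bounded_closed)
next
  fix u v assume u: "u \<in> rank_polytope r" and v: "v \<in> nonneg_orthant" "v \<le> u"
  have "weight v A \<le> weight u A" for A
    using v by (intro weight_mono) (auto simp: less_eq_vec_def)
  then show "v \<in> rank_polytope r"
    using u v(1) by (auto simp: rank_polytope_def intro: order_trans)
next
  fix u v assume u: "u \<in> rank_polytope r" and v: "v \<in> rank_polytope r"
    and "modulus u < modulus v"
  then obtain i where i: "u $ i < v $ i" "\<And>A. i \<in> A \<Longrightarrow> weight u A < r A"
    using nontight_coordinate[OF assms(1)] by metis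
  have "\<exists>e>0. \<forall>s. 0 \<le> s \<and> s < e \<longrightarrow> u + s *\<^sub>R axis i 1 \<in> rank_polytope r"
  proof (rule perturb[OF u])
    show "0 \<le> axis i (1 :: real) $ j \<or> 0 < u $ j" for j by (simp add: axis_def)
    show "weight (axis i 1) A \<le> 0 \<or> weight u A < r A" for A using i(2) by (simp add: weight_axis)
  qed
  then obtain e where e: "e > 0" "\<And>s. 0 \<le> s \<Longrightarrow> s < e \<Longrightarrow> u + s *\<^sub>R axis i 1 \<in> rank_polytope r"
    by blast
  define s where "s = min (e / 2) (v $ i - u $ i)"
  have s: "0 < s" "s < e" "u $ i + s \<le> v $ i" using e(1) i(1) by (auto simp: s_def)
  show "\<exists>w\<in>rank_polytope r. u < w \<and> w \<le> sup u v"
    using s e(2)[of s]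
    by (intro bexI[of _ "u + s *\<^sub>R axis i 1"])
       (auto simp: less_vec_iff less_eq_vec_def axis_def)
qed (use ne in \<open>auto simp: rank_polytope_def\<close>)

lemma convex_rank_polytope: "convex (rank_polytope r)"
  unfolding convex_def
proof (intro ballI allI impI)
  fix x y and s t :: real
  assume x: "x \<in> rank_polytope r" and y: "y \<in> rank_polytope r"
    and st: "0 \<le> s" "0 \<le> t" "s + t = 1"
  have "s * weight x A + t * weight y A \<le> r A" for A
    using x y st by (intro convex_bound_le) (auto simp: rank_polytope_def)
  then show "s *\<^sub>R x + t *\<^sub>R y \<in> rank_polytope r"
    using x y st by (auto simp: rank_polytope_def nonneg_orthant_def weight_add weight_scaleR)
qed

lemma not_extreme_if_direction:
  assumes x: "x extreme_point_of rank_polytope r"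
    and dir: "\<And>i. d $ i \<noteq> 0 \<Longrightarrow> 0 < x $ i"
    and tight: "\<And>A. weight x A = r A \<Longrightarrow> weight d A = 0"
  shows "d = 0"
proof (rule ccontr)
  assume "d \<noteq> 0"
  have xQ: "x \<in> rank_polytope r" using x by (simp add: extreme_point_of_def)
  then have slack: "weight d A = 0 \<or> weight x A < r A" for A
    using tight[of A] by (force simp: rank_polytope_def order.strict_iff_order)
  have neg: "weight (- d) A = - weight d A" for A by (simp add: weight_def sum_negf)
  have "\<exists>e>0. \<forall>s. 0 \<le> s \<and> s < e \<longrightarrow> x + s *\<^sub>R d \<in> rank_polytope r"
    using slack dir by (intro perturb[OF xQ]) (metis order.refl)+
  moreover have "\<exists>e>0. \<forall>s. 0 \<le> s \<and> s < e \<longrightarrow> x + s *\<^sub>R (- d) \<in> rank_polytope r"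
  proof (rule perturb[OF xQ])
    show "0 \<le> (- d) $ i \<or> 0 < x $ i" for i using dir[of i] by force
    show "weight (- d) A \<le> 0 \<or> weight x A < r A" for A using slack[of A] by (auto simp: neg)
  qed
  ultimately obtain e e' where e: "e > 0" "e' > 0"
    "\<And>s. 0 \<le> s \<Longrightarrow> s < e \<Longrightarrow> x + s *\<^sub>R d \<in> rank_polytope r"
    "\<And>s. 0 \<le> s \<Longrightarrow> s < e' \<Longrightarrow> x + s *\<^sub>R (- d) \<in> rank_polytope r"
    by metis
  define s where "s = min e e' / 2"
  have s: "0 < s" "s < e" "s < e'" using e(1,2) by (auto simp: s_def)
  have "x = midpoint (x + s *\<^sub>R d) (x + s *\<^sub>R (- d))"
    by (simp add: midpoint_def algebra_simps flip: scaleR_2)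
  moreover have "x + s *\<^sub>R d \<noteq> x + s *\<^sub>R (- d)"
    using s(1) \<open>d \<noteq> 0\<close> by (simp add: eq_neg_iff_add_eq_0 flip: scaleR_2)
  ultimately have "x \<in> open_segment (x + s *\<^sub>R d) (x + s *\<^sub>R (- d))"
    by (metis midpoint_in_open_segment)
  moreover have "x + s *\<^sub>R d \<in> rank_polytope r" "x + s *\<^sub>R (- d) \<in> rank_polytope r"
    using e(3,4) s by auto
  ultimately show False using x unfolding extreme_point_of_def by blast
qed

text \<open>
  Suppose that \<open>x\<close> has a fractional coordinate.  If no tight set contains one, \<open>x\<close> can be moved
  along that axis in both directions.  Otherwise let \<open>A\<close> be a smallest tight set containing a
  fractional coordinate.  As \<open>x(A)\<close> is an integer, \<open>A\<close> contains two of them, \<open>j\<close> and \<open>k\<close>.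
  Tight sets are closed under intersection, so by minimality no tight set separates \<open>j\<close> from
  \<open>k\<close>, and mass can be shifted between the two in both directions.
\<close>

lemma extreme_point_integral:
  fixes r :: "'n::finite set \<Rightarrow> real"
  assumes sub: "submodular r" and int: "\<And>A. r A \<in> \<int>" and x: "x extreme_point_of rank_polytope r"
  shows "x \<in> integer_lattice"
proof (rule ccontr)
  have xQ: "x \<in> rank_polytope r" using x by (simp add: extreme_point_of_def)
  have pos: "0 < x $ i" if "x $ i \<notin> \<int>" for i
  proof -
    have "0 \<le> x $ i" using xQ by (simp add: rank_polytope_def nonneg_orthant_def)
    moreover have "x $ i \<noteq> 0" using that by auto
    ultimately show ?thesis by simp
  qed
  assume "x \<notin> integer_lattice"
  then obtain i where i: "x $ i \<notin> \<int>" by (auto simp: integer_lattice_def)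
  define \<T> where "\<T> A \<longleftrightarrow> weight x A = r A \<and> (\<exists>j\<in>A. x $ j \<notin> \<int>)" for A
  show False
  proof (cases "\<exists>A. \<T> A")
    case False
    have "axis i 1 = (0 :: real ^ 'n)"
    proof (rule not_extreme_if_direction[OF x])
      show "0 < x $ j" if "axis i 1 $ j \<noteq> (0 :: real)" for j
        using that pos[OF i] by (auto simp: axis_def split: if_splits)
      show "weight (axis i 1) A = 0" if "weight x A = r A" for A
        using that False i by (auto simp: weight_axis \<T>_def)
    qed
    then show False by (simp add: axis_eq_0_iff)
  next
    case True
    then obtain A where A: "\<T> A" "\<And>B. \<T> B \<Longrightarrow> card A \<le> card B"
      by (metis ex_has_least_nat)
    then obtain j where j: "j \<in> A" "x $ j \<notin> \<int>" by (auto simp: \<T>_def)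
    have "weight x A \<in> \<int>" using A(1) int by (simp add: \<T>_def)
    moreover have "weight x A = x $ j + weight x (A - {j})"
      unfolding weight_def using j(1) by (simp add: sum.remove)
    ultimately have "weight x (A - {j}) \<notin> \<int>"
      using j(2) by (metis Ints_diff add_diff_cancel_right')
    then obtain k where k: "k \<in> A" "k \<noteq> j" "x $ k \<notin> \<int>"
      unfolding weight_def by (metis DiffE Ints_sum singletonI)
    have both: "B \<supseteq> A" if "weight x B = r B" "j \<in> B \<or> k \<in> B" for B
    proof -
      have "weight x (A \<inter> B) = r (A \<inter> B)"
        using tight_Un_Int(2)[OF sub xQ, of A B] A(1) that(1) by (simp add: \<T>_def)
      then have "\<T> (A \<inter> B)" using that(2) j k by (auto simp: \<T>_def)
      then have "card A \<le> card (A \<inter> B)" by (rule A(2))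
      then show ?thesis by (metis Int_lower1 card_seteq finite inf.absorb_iff1)
    qed
    define d where "d = (axis j 1 - axis k 1 :: real ^ 'n)"
    have wd: "weight d B = (if j \<in> B then 1 else 0) - (if k \<in> B then 1 else 0)" for B
    proof -
      have "d = axis j 1 + axis k (- 1)" by (auto simp: d_def vec_eq_iff axis_def)
      then show ?thesis by (simp only: weight_add weight_axis) simp
    qed
    have "d = 0"
    proof (rule not_extreme_if_direction[OF x])
      show "0 < x $ i" if "d $ i \<noteq> 0" for i
        using that j k pos by (auto simp: d_def axis_def split: if_splits)
      show "weight d B = 0" if "weight x B = r B" for B
        using both[OF that] j(1) k(1) by (auto simp: wd)
    qed
    moreover have "d $ j = 1" using k(2) by (simp add: d_def axis_def)
    ultimately show False by simp
  qed
qed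

section \<open>Discrete polymatroids and integral polymatroids\<close>

lemma grid_polymatroid_discrete:
  assumes "discrete_polymatroid P"
  shows "grid_polymatroid integer_lattice P"
  using assms unfolding discrete_polymatroid_def
  by unfold_locales (auto simp: integer_lattice_def finite_imp_compact)

lemma grid_polymatroid_UNIV:
  assumes "polymatroid S"
  shows "grid_polymatroid UNIV S"
  using assms unfolding polymatroid_def by unfold_locales auto

lemma weight_integral: "u \<in> integer_lattice \<Longrightarrow> weight u A \<in> \<int>"
  by (auto simp: weight_def integer_lattice_def)

theorem convex_hull_discrete:
  assumes P: "discrete_polymatroid P"
  shows "integral_polymatroid (convex hull P)" "convex hull P \<inter> integer_lattice = P"
proof -
  interpret grid_polymatroid integer_lattice P
    by (rule grid_polymatroid_discrete[OF P])
  let ?Q = "rank_polytope (rank_of P)"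
  have int: "rank_of P A \<in> \<int>" for A
    using rank_attained[of A] subset weight_integral by (metis IntD2 in_mono)
  have PQ: "P = ?Q \<inter> integer_lattice" by (rule eq_rank_polytope)
  have poly: "polymatroid ?Q"
    using PQ nonempty by (intro polymatroid_rank_polytope submodular_rank) auto
  have ext: "x \<in> integer_lattice" if "x extreme_point_of ?Q" for x
    using extreme_point_integral[OF submodular_rank int that] .
  have "?Q = convex hull {x. x extreme_point_of ?Q}"
    using poly by (intro Krein_Milman_Minkowski convex_rank_polytope) (simp add: polymatroid_def)
  also have "\<dots> \<subseteq> convex hull P"
    using ext PQ by (intro hull_mono) (auto simp: extreme_point_of_def)
  finally have eq: "convex hull P = ?Q"
    using PQ by (intro order.antisym hull_minimal convex_rank_polytope) auto
  show "integral_polymatroid (convex hull P)"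
    unfolding eq integral_polymatroid_def using poly ext by blast
  show "convex hull P \<inter> integer_lattice = P"
    unfolding eq using PQ by simp
qed

theorem discrete_of_convex_hull:
  assumes ne: "P \<noteq> {}" and fin: "finite P" and sub: "P \<subseteq> nonneg_orthant \<inter> integer_lattice"
    and poly: "polymatroid (convex hull P)" and eq: "convex hull P \<inter> integer_lattice = P"
  shows "discrete_polymatroid P"
proof -
  let ?S = "convex hull P"
  interpret grid_polymatroid UNIV ?S
    by (rule grid_polymatroid_UNIV[OF poly])
  let ?r = "rank_of ?S"
  have SQ: "?S = rank_polytope ?r" using eq_rank_polytope by simp
  have int: "?r A \<in> \<int>" for A
  proof -
    obtain p where p: "p \<in> P" "\<And>q. q \<in> P \<Longrightarrow> weight q A \<le> weight p A"
      using continuous_attains_sup[OF finite_imp_compact[OF fin] ne continuous_on_weight] by metis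
    have "convex {x. weight x A \<le> weight p A}"
      by (auto simp: convex_def weight_add weight_scaleR intro: convex_bound_le)
    then have "?S \<subseteq> {x. weight x A \<le> weight p A}"
      using p(2) by (intro hull_minimal) auto
    then have "?r A \<le> weight p A" using rank_attained[of A] by force
    moreover have "weight p A \<le> ?r A" using p(1) by (intro weight_le_rank hull_inc)
    ultimately show ?thesis using p(1) sub weight_integral[of p A] by auto
  qed
  show ?thesis
    unfolding discrete_polymatroid_def
  proof (intro conjI ballI impI ne fin sub)
    fix u v assume "u \<in> P" "v \<in> nonneg_orthant \<inter> integer_lattice" "v \<le> u"
    then show "v \<in> P" using down[of u v] eq hull_inc[of u P convex] by auto
  next
    fix u v assume u: "u \<in> P" and v: "v \<in> P" and "modulus u < modulus v"
    have uQ: "u \<in> rank_polytope ?r" and "v \<in> rank_polytope ?r"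
      using hull_inc[OF u, of convex] hull_inc[OF v, of convex] SQ by auto
    then obtain i where i: "u $ i < v $ i" "\<And>A. i \<in> A \<Longrightarrow> weight u A < ?r A"
      using nontight_coordinate[OF submodular_rank] \<open>modulus u < modulus v\<close> by metis
    have lat: "u \<in> integer_lattice" "v \<in> integer_lattice" using u v sub by auto
    have step: "a + 1 \<le> b" if "a \<in> \<int>" "b \<in> \<int>" "a < b" for a b :: real
      using that by (auto elim!: Ints_cases)
    define w where "w = u + axis i 1"
    have "weight w A \<le> ?r A" for A
      using i(2)[of A] step[OF weight_integral[OF lat(1)] int] uQ
      by (auto simp: w_def weight_add weight_axis rank_polytope_def)
    moreover have "w \<in> nonneg_orthant" "w \<in> integer_lattice"
      using u sub by (auto simp: w_def nonneg_orthant_def integer_lattice_def axis_def)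
    ultimately have "w \<in> P" using eq SQ by (auto simp: rank_polytope_def)
    moreover have "u $ i + 1 \<le> v $ i"
      using i(1) lat by (intro step) (auto simp: integer_lattice_def)
    then have "u < w" "w \<le> sup u v"
      by (auto simp: w_def less_vec_iff less_eq_vec_def axis_def)
    ultimately show "\<exists>w\<in>P. u < w \<and> w \<le> sup u v" by blast
  qed
qed

theorem theorem3p4:
  fixes P :: "(real ^ 'n) set"
  assumes "P \<noteq> {}" and "finite P" and "P \<subseteq> nonneg_orthant \<inter> integer_lattice"
  shows "discrete_polymatroid P \<longleftrightarrow>
    integral_polymatroid (convex hull P) \<and> convex hull P \<inter> integer_lattice = P"
  using convex_hull_discrete discrete_of_convex_hull[OF assms]
  by (auto simp: integral_polymatroid_def)

end
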